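(* Let $\phi\in\mathcal{A}$, let $f_1=h_1+\overline{g_1}\in\mathcal{W}_H^-(z)$ (that is, $h_1(z)-g_1(z)=z$) and let $f_2=h_2+\overline{g_2}\in\mathcal{W}_H^-(\phi)$ (that is, $h_2-g_2=\phi$). Then: (i) $f_1*f_2\in\mathcal{W}_H^-(h_1*\phi)$; (ii) if the analytic function $h_1*\phi$ is univalent in $\mathbb{D}$ and convex in the direction of the real axis, and $$\operatorname{Re}\frac{(h_1*h_2)'(z)}{(h_1*\phi)'(z)}>\frac12,\qquad z\in\mathbb{D},$$ then $f_1*f_2\in\mathcal{S}_H^0$ and $f_1*f_2$ is convex in the direction of the real axis.
   Context: Let $\mathbb{D}=\{z\in\mathbb{C}:|z|<1\}$. $\mathcal{H}$ is the class of complex-valued harmonic functions $f$ in $\mathbb{D}$ with $f(0)=0=f_z(0)-1=f_{\bar z}(0)$. Each such $f$ is written $f=h+\overline{g}$ with $h(z)=z+\sum_{n\ge2}a_nz^n$ and $g(z)=\sum_{n\ge2}b_nz^n$ analytic in $\mathbb{D}$; this is the meaning of $h,g$ (and $h_i,g_i$) below. $\mathcal{A}\subset\mathcal{H}$ is the subclass of analytic functions, i.e. analytic $\phi$ in $\mathbb{D}$ with $\phi(0)=0$, $\phi'(0)=1$. For $\phi\in\mathcal{A}$, $\mathcal{W}_H^-(\phi)=\{f=h+\overline{g}\in\mathcal{H}: h-g=\phi\}$; $\mathcal{W}_H^-(z)$ is the case $\phi(z)\equiv z$. A function $f\in\mathcal{H}$ is sense-preserving if $|g'|<|h'|$ in $\mathbb{D}$.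 $\mathcal{S}_H^0$ is the class of $f\in\mathcal{H}$ that are univalent (injective) and sense-preserving in $\mathbb{D}$. A domain is convex in the direction of the real axis if its intersection with each horizontal line is connected; $f\in\mathcal{H}$ is convex in the direction of the real axis if it maps $\mathbb{D}$ onto a domain convex in that direction. Convolution: for analytic power series, $(\sum a_nz^n)*(\sum A_nz^n)=\sum a_nA_nz^n$; for $f=h+\overline g$, $F=H+\overline G$ in $\mathcal{H}$, $f*F=h*H+\overline{g*G}$. *)

theory Defs
  imports "HOL-Complex_Analysis.Complex_Analysis"
begin

abbreviation unit_disc :: "complex set" where
  "unit_disc \<equiv> ball 0 1"

text \<open>All functions below are total functions on the complex plane; only their values on
  the unit disc matter.\<close>

definition pdx :: "(complex \<Rightarrow> complex) \<Rightarrow> complex \<Rightarrow> complex" where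
  "pdx f z = frechet_derivative f (at z) 1"

definition pdy :: "(complex \<Rightarrow> complex) \<Rightarrow> complex \<Rightarrow> complex" where
  "pdy f z = frechet_derivative f (at z) \<i>"

definition wirtinger_z :: "(complex \<Rightarrow> complex) \<Rightarrow> complex \<Rightarrow> complex" where
  "wirtinger_z f z = (pdx f z - \<i> * pdy f z) / 2"

definition wirtinger_zbar :: "(complex \<Rightarrow> complex) \<Rightarrow> complex \<Rightarrow> complex" where
  "wirtinger_zbar f z = (pdx f z + \<i> * pdy f z) / 2"

text \<open>Twice continuously (real) differentiable with vanishing Laplacian; meant for open \<open>S\<close>.\<close>

definition harmonic_on :: "(complex \<Rightarrow> complex) \<Rightarrow> complex set \<Rightarrow> bool"
    (infixl \<open>harmonic'_on\<close> 50) where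
  "f harmonic_on S \<longleftrightarrow>
     (\<forall>z\<in>S. f differentiable (at z) \<and> pdx f differentiable (at z) \<and> pdy f differentiable (at z)) \<and>
     continuous_on S (pdx (pdx f)) \<and> continuous_on S (pdy (pdx f)) \<and>
     continuous_on S (pdx (pdy f)) \<and> continuous_on S (pdy (pdy f)) \<and>
     (\<forall>z\<in>S. pdx (pdx f) z + pdy (pdy f) z = 0)"

definition class_H :: "(complex \<Rightarrow> complex) set" where
  "class_H = {f. f harmonic_on unit_disc \<and> f 0 = 0 \<and> wirtinger_z f 0 = 1 \<and> wirtinger_zbar f 0 = 0}"

definition class_A :: "(complex \<Rightarrow> complex) set" where
  "class_A = {\<phi>. \<phi> holomorphic_on unit_disc \<and> \<phi> 0 = 0 \<and> deriv \<phi> 0 = 1}"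

text \<open>\<open>f = h + cnj g\<close> on the disc, where \<open>h(z) = z + a\<^sub>2 z^2 + \<dots>\<close> and
  \<open>g(z) = b\<^sub>2 z^2 + \<dots>\<close>. On the disc, \<open>h\<close> and \<open>g\<close> are uniquely determined by \<open>f\<close>, and
  every member of \<open>class_H\<close> has such a decomposition.\<close>

definition canonical_decomp ::
    "(complex \<Rightarrow> complex) \<Rightarrow> (complex \<Rightarrow> complex) \<Rightarrow> (complex \<Rightarrow> complex) \<Rightarrow> bool" where
  "canonical_decomp f h g \<longleftrightarrow>
     h holomorphic_on unit_disc \<and> h 0 = 0 \<and> deriv h 0 = 1 \<and>
     g holomorphic_on unit_disc \<and> g 0 = 0 \<and> deriv g 0 = 0 \<and>
     (\<forall>z\<in>unit_disc. f z = h z + cnj (g z))"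

definition analytic_part :: "(complex \<Rightarrow> complex) \<Rightarrow> complex \<Rightarrow> complex" where
  "analytic_part f = (SOME h. \<exists>g. canonical_decomp f h g)"

definition coanalytic_part :: "(complex \<Rightarrow> complex) \<Rightarrow> complex \<Rightarrow> complex" where
  "coanalytic_part f = (SOME g. \<exists>h. canonical_decomp f h g)"

definition W_H_minus :: "(complex \<Rightarrow> complex) \<Rightarrow> (complex \<Rightarrow> complex) set" where
  "W_H_minus \<phi> =
     {f \<in> class_H. \<exists>h g. canonical_decomp f h g \<and> (\<forall>z\<in>unit_disc. h z - g z = \<phi> z)}"

definition sense_preserving :: "(complex \<Rightarrow> complex) \<Rightarrow> bool" where
  "sense_preserving f \<longleftrightarrow>
     (\<exists>h g. canonical_decomp f h g \<and> (\<forall>z\<in>unit_disc. norm (deriv g z) < norm (deriv h z)))"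

definition class_S_H0 :: "(complex \<Rightarrow> complex) set" where
  "class_S_H0 = {f \<in> class_H. inj_on f unit_disc \<and> sense_preserving f}"

definition convex_real_direction :: "complex set \<Rightarrow> bool" where
  "convex_real_direction S \<longleftrightarrow> (\<forall>c. connected (S \<inter> {w. Im w = c}))"

definition maps_convex_real_direction :: "(complex \<Rightarrow> complex) \<Rightarrow> bool" where
  "maps_convex_real_direction f \<longleftrightarrow>
     open (f ` unit_disc) \<and> connected (f ` unit_disc) \<and> convex_real_direction (f ` unit_disc)"

definition analytic_conv ::
    "(complex \<Rightarrow> complex) \<Rightarrow> (complex \<Rightarrow> complex) \<Rightarrow> complex \<Rightarrow> complex"
    (infixl \<open>\<star>\<close> 70) where
  "h \<star> H = eval_fps (Abs_fps (\<lambda>n. fps_nth (fps_expansion h 0) n * fps_nth (fps_expansion H 0) n))"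

definition harmonic_conv ::
    "(complex \<Rightarrow> complex) \<Rightarrow> (complex \<Rightarrow> complex) \<Rightarrow> complex \<Rightarrow> complex"
    (infixl \<open>\<star>\<^sub>H\<close> 70) where
  "f \<star>\<^sub>H F = (\<lambda>z. (analytic_part f \<star> analytic_part F) z +
                    cnj ((coanalytic_part f \<star> coanalytic_part F) z))"

end

theory Submission
  imports Defs
begin

text \<open>
  Write \<open>H = h1 \<star> h2\<close> and \<open>G = g1 \<star> g2\<close>, so that \<open>f1 \<star>\<^sub>H f2 = H + cnj G\<close>.

  For (i), let \<open>a, b\<close> be the Taylor coefficients of \<open>h1, g1\<close> and \<open>A, B\<close> those of \<open>h2, g2\<close>.
  As \<open>h1 - g1\<close> is the identity, \<open>a n = b n\<close> except for \<open>n = 1\<close>, and there \<open>B 1 = 0\<close>. Hence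
  \<open>a n * A n - b n * B n = a n * (A n - B n)\<close> for all \<open>n\<close>, that is, \<open>H - G = h1 \<star> \<phi>\<close>
  (lemma \<open>analytic_conv_diff\<close>).

  Part (ii) is then the shear construction of Clunie and Sheil-Small (lemma \<open>shear_univalent\<close>).
  Put \<open>\<Phi> = H - G\<close>. As \<open>H + cnj G = \<Phi> + 2 * Re G\<close>, in the coordinate \<open>w = \<Phi> z\<close> the function becomes
  \<open>w \<mapsto> w + 2 * Re (G (\<Phi>\<^sup>-\<^sup>1 w))\<close>, which maps every horizontal line into itself. The line meets
  the image of \<open>\<Phi>\<close> in an interval, and on it the derivative is
  \<open>1 + 2 * Re (G' / \<Phi>') = 2 * Re (H' / \<Phi>') - 1 > 0\<close>. So the function is increasing on each
  line: it is injective, and it maps intervals to intervals. The same inequality says that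
  \<open>t = H' / \<Phi>'\<close> is closer to \<open>1\<close> than to \<open>0\<close>; as \<open>G' / \<Phi>' = t - 1\<close>, this means \<open>|G'| < |H'|\<close>.
  Finally, an injective continuous function on the disc has an open image, by invariance of
  domain.
\<close>

section \<open>Wirtinger derivatives of sums of a holomorphic and an antiholomorphic function\<close>

lemma has_derivative_holomorphic_plus_cnj:
  assumes "open S" "h holomorphic_on S" "g holomorphic_on S"
    and f: "\<And>z. z \<in> S \<Longrightarrow> f z = h z + cnj (g z)" and "z \<in> S"
  shows "(f has_derivative (\<lambda>v. deriv h z * v + cnj (deriv g z * v))) (at z)"
proof -
  have "(h has_derivative (*) (deriv h z)) (at z)" "(g has_derivative (*) (deriv g z)) (at z)"
    using assms holomorphic_derivI has_field_derivative_def by metis+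
  then have "((\<lambda>z. h z + cnj (g z)) has_derivative (\<lambda>v. deriv h z * v + cnj (deriv g z * v))) (at z)"
    by (intro has_derivative_add bounded_linear.has_derivative[OF bounded_linear_cnj])
  then show ?thesis
    by (rule has_derivative_transform_within_open) (use assms in auto)
qed

lemma
  assumes "open S" "h holomorphic_on S" "g holomorphic_on S"
    and "\<And>z. z \<in> S \<Longrightarrow> f z = h z + cnj (g z)" and "z \<in> S"
  shows pdx_holomorphic_plus_cnj: "pdx f z = deriv h z + cnj (deriv g z)"
    and pdy_holomorphic_plus_cnj: "pdy f z = \<i> * deriv h z + cnj (\<i> * deriv g z)"
    and wirtinger_z_holomorphic_plus_cnj: "wirtinger_z f z = deriv h z"
    and wirtinger_zbar_holomorphic_plus_cnj: "wirtinger_zbar f z = cnj (deriv g z)"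
proof -
  have *: "frechet_derivative f (at z) = (\<lambda>v. deriv h z * v + cnj (deriv g z * v))"
    using frechet_derivative_at[OF has_derivative_holomorphic_plus_cnj[OF assms]] by simp
  show x: "pdx f z = deriv h z + cnj (deriv g z)"
    and y: "pdy f z = \<i> * deriv h z + cnj (\<i> * deriv g z)"
    by (simp_all add: pdx_def pdy_def *)
  show "wirtinger_z f z = deriv h z" "wirtinger_zbar f z = cnj (deriv g z)"
    by (simp_all add: wirtinger_z_def wirtinger_zbar_def x y algebra_simps)
qed

lemma harmonic_on_holomorphic_plus_cnj:
  assumes S: "open S" and h: "h holomorphic_on S" and g: "g holomorphic_on S"
    and f: "\<And>z. z \<in> S \<Longrightarrow> f z = h z + cnj (g z)"
  shows "f harmonic_on S"
proof -
  note x = pdx_holomorphic_plus_cnj and y = pdy_holomorphic_plus_cnj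
  have h': "deriv h holomorphic_on S" "(\<lambda>z. \<i> * deriv h z) holomorphic_on S"
    and g': "deriv g holomorphic_on S" "(\<lambda>z. \<i> * deriv g z) holomorphic_on S"
    using S h g by (auto intro!: holomorphic_intros)
  have h'': "deriv (deriv h) holomorphic_on S" and g'': "deriv (deriv g) holomorphic_on S"
    using S h' g' by (auto intro!: holomorphic_intros)
  note c = holomorphic_on_imp_continuous_on[OF h''] holomorphic_on_imp_continuous_on[OF g'']
  note fx = x[OF S h g f] and fy = y[OF S h g f]
  have i: "deriv (\<lambda>z. \<i> * deriv h z) z = \<i> * deriv (deriv h) z"
          "deriv (\<lambda>z. \<i> * deriv g z) z = \<i> * deriv (deriv g) z" if "z \<in> S" for z
    using S h'(1) g'(1) that by (auto intro!: deriv_cmult holomorphic_on_imp_differentiable_at)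
  have xx: "pdx (pdx f) z = deriv (deriv h) z + cnj (deriv (deriv g) z)"
   and xy: "pdy (pdx f) z = \<i> * deriv (deriv h) z + cnj (\<i> * deriv (deriv g) z)"
   and yx: "pdx (pdy f) z = \<i> * deriv (deriv h) z + cnj (\<i> * deriv (deriv g) z)"
   and yy: "pdy (pdy f) z = - deriv (deriv h) z - cnj (deriv (deriv g) z)" if "z \<in> S" for z
    using x[OF S h'(1) g'(1) fx that] y[OF S h'(1) g'(1) fx that] 
      x[OF S h'(2) g'(2) fy that] y[OF S h'(2) g'(2) fy that] i[OF that]
    by (simp_all add: algebra_simps)
  have "continuous_on S (pdx (pdx f))" "continuous_on S (pdy (pdx f))"
    "continuous_on S (pdx (pdy f))" "continuous_on S (pdy (pdy f))"
    using xx xy yx yy by (simp_all cong: continuous_on_cong) (intro continuous_intros c)+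
  moreover have "f differentiable (at z)" "pdx f differentiable (at z)" "pdy f differentiable (at z)"
    if "z \<in> S" for z
    using has_derivative_holomorphic_plus_cnj[OF S h g f that]
      has_derivative_holomorphic_plus_cnj[OF S h'(1) g'(1) fx that]
      has_derivative_holomorphic_plus_cnj[OF S h'(2) g'(2) fy that]
    by (blast intro: differentiableI)+
  ultimately show ?thesis
    unfolding harmonic_on_def using xx yy by simp
qed

lemma canonical_decomp_imp_class_H:
  assumes "canonical_decomp f h g"
  shows "f \<in> class_H"
proof -
  have hg: "h holomorphic_on unit_disc" "g holomorphic_on unit_disc"
    and f: "\<And>z. z \<in> unit_disc \<Longrightarrow> f z = h z + cnj (g z)"
    and 0: "h 0 = 0" "g 0 = 0" "deriv h 0 = 1" "deriv g 0 = 0"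
    using assms by (auto simp: canonical_decomp_def)
  show ?thesis
    using harmonic_on_holomorphic_plus_cnj[OF open_ball hg f]
      wirtinger_z_holomorphic_plus_cnj[OF open_ball hg f, of 0]
      wirtinger_zbar_holomorphic_plus_cnj[OF open_ball hg f, of 0] f[of 0]
    by (simp add: class_H_def 0)
qed

lemma holomorphic_on_ball_eqI:
  assumes "f holomorphic_on ball a r" "g holomorphic_on ball a r"
    and "\<And>z. z \<in> ball a r \<Longrightarrow> deriv f z = deriv g z" and "f a = g a" and z: "z \<in> ball a r"
  shows "f z = g z"
proof -
  have "\<exists>c. \<forall>z\<in>ball a r. f z - g z = c"
  proof (rule has_field_derivative_zero_constant)
    fix z assume z: "z \<in> ball a r"
    have "(f has_field_derivative deriv f z) (at z)" "(g has_field_derivative deriv f z) (at z)"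
      using assms(1-3) z holomorphic_derivI[OF _ open_ball] by metis+
    then show "((\<lambda>z. f z - g z) has_field_derivative 0) (at z within ball a r)"
      using DERIV_diff has_field_derivative_at_within by fastforce
  qed simp
  moreover have "a \<in> ball a r"
    using z by (metis centre_in_ball ball_eq_empty empty_iff not_le)
  ultimately show ?thesis
    using z assms(4) by (metis eq_iff_diff_eq_0)
qed

text \<open>The real derivative of \<open>f = h + cnj g\<close> splits into a complex-linear part with coefficient
  \<open>deriv h\<close> and a conjugate-linear part with coefficient \<open>cnj (deriv g)\<close>. Hence the Wirtinger
  derivatives of \<open>f\<close> determine the derivatives of both parts, and the values at \<open>0\<close> fix the
  constants of integration.\<close>

lemma canonical_decomp_unique:
  assumes "canonical_decomp f h g" "canonical_decomp f h' g'" "z \<in> unit_disc"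
  shows "h z = h' z" and "g z = g' z"
proof -
  have hol: "h holomorphic_on unit_disc" "g holomorphic_on unit_disc"
    "h' holomorphic_on unit_disc" "g' holomorphic_on unit_disc"
    and f: "\<And>z. z \<in> unit_disc \<Longrightarrow> f z = h z + cnj (g z)"
      "\<And>z. z \<in> unit_disc \<Longrightarrow> f z = h' z + cnj (g' z)"
    and 0: "h 0 = h' 0" "g 0 = g' 0"
    using assms(1,2) unfolding canonical_decomp_def by auto
  have "deriv h z = deriv h' z" "deriv g z = deriv g' z" if "z \<in> unit_disc" for z
    using wirtinger_z_holomorphic_plus_cnj[OF open_ball hol(1,2) f(1) that]
      wirtinger_z_holomorphic_plus_cnj[OF open_ball hol(3,4) f(2) that]
      wirtinger_zbar_holomorphic_plus_cnj[OF open_ball hol(1,2) f(1) that]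
      wirtinger_zbar_holomorphic_plus_cnj[OF open_ball hol(3,4) f(2) that]
    by auto
  then show "h z = h' z" and "g z = g' z"
    using holomorphic_on_ball_eqI hol 0 assms(3) by blast+
qed

section \<open>Hadamard products of power series\<close>

lemma fps_expansion_cong_disc:
  assumes "\<And>z. z \<in> unit_disc \<Longrightarrow> f z = g z"
  shows "fps_expansion f 0 = fps_expansion g 0"
proof (rule fps_expansion_cong)
  show "\<forall>\<^sub>F w in nhds 0. f w = g w"
    using eventually_nhds_in_open[of unit_disc 0] assms by (auto elim: eventually_mono)
qed

text \<open>The convolution only depends on Taylor coefficients at \<open>0\<close>, so uniqueness on the disc is
  enough for the arbitrary choice in \<open>analytic_part\<close> and \<open>coanalytic_part\<close> not to matter.\<close>

lemma
  assumes "canonical_decomp f h g"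
  shows fps_expansion_analytic_part: "fps_expansion (analytic_part f) 0 = fps_expansion h 0"
    and fps_expansion_coanalytic_part: "fps_expansion (coanalytic_part f) 0 = fps_expansion g 0"
proof -
  have "\<exists>g'. canonical_decomp f (analytic_part f) g'"
    unfolding analytic_part_def using assms by (intro someI[of "\<lambda>h. \<exists>g. canonical_decomp f h g"]) blast
  then show "fps_expansion (analytic_part f) 0 = fps_expansion h 0"
    using canonical_decomp_unique(1) assms by (blast intro: fps_expansion_cong_disc)
  have "\<exists>h'. canonical_decomp f h' (coanalytic_part f)"
    unfolding coanalytic_part_def using assms by (intro someI[of "\<lambda>g. \<exists>h. canonical_decomp f h g"]) blast
  then show "fps_expansion (coanalytic_part f) 0 = fps_expansion g 0"
    using canonical_decomp_unique(2) assms by (blast intro: fps_expansion_cong_disc)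
qed

lemma harmonic_conv_eq:
  assumes "canonical_decomp f h g" "canonical_decomp F H G"
  shows "f \<star>\<^sub>H F = (\<lambda>z. (h \<star> H) z + cnj ((g \<star> G) z))"
  using assms
  by (simp add: harmonic_conv_def analytic_conv_def fps_expansion_analytic_part
      fps_expansion_coanalytic_part)

text \<open>For \<open>r < 1\<close> the point \<open>s = sqrt r\<close> still lies inside both discs of convergence. The \<open>n\<close>-th term
  of the product series at \<open>r = s * s\<close> is the product of the terms of the two series at \<open>s\<close>, the first
  bounded and the second absolutely summable.\<close>

lemma fps_conv_radius_Hadamard_ge_1:
  fixes f g :: "complex fps"
  assumes "fps_conv_radius f \<ge> 1" "fps_conv_radius g \<ge> 1"
  shows "fps_conv_radius (Abs_fps (\<lambda>n. fps_nth f n * fps_nth g n)) \<ge> 1"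
  unfolding fps_conv_radius_def
proof (rule conv_radius_geI_ex')
  fix r :: real assume r: "0 < r" "ereal r < 1"
  define s where "s = complex_of_real (sqrt r)"
  have s: "ereal (norm s) < 1" using r by (simp add: s_def one_ereal_def)
  have ss: "s * s = of_real r"
    using r by (simp add: s_def flip: of_real_mult)
  have "summable (\<lambda>n. fps_nth f n * s ^ n)"
    and g: "summable (\<lambda>n. norm (fps_nth g n * s ^ n))"
    by (intro summable_fps norm_summable_fps order.strict_trans2[OF s] assms)+
  then obtain K where K: "\<And>n. norm (fps_nth f n * s ^ n) \<le> K"
    using summable_imp_Bseq by (auto simp: Bseq_def)
  have "summable (\<lambda>n. (fps_nth f n * s ^ n) * (fps_nth g n * s ^ n))"
  proof (rule summable_comparison_test'[OF summable_mult[OF g, of K]])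
    fix n
    show "norm ((fps_nth f n * s ^ n) * (fps_nth g n * s ^ n)) \<le> K * norm (fps_nth g n * s ^ n)"
      unfolding norm_mult[of "fps_nth f n * s ^ n"] by (intro mult_right_mono K norm_ge_zero)
  qed
  then show "summable (\<lambda>n. fps_nth (Abs_fps (\<lambda>n. fps_nth f n * fps_nth g n)) n * of_real r ^ n)"
    by (simp add: ss[symmetric] power_mult_distrib mult_ac)
qed

lemma fps_conv_radius_expansion_ge_1:
  assumes "f holomorphic_on unit_disc"
  shows "fps_conv_radius (fps_expansion f 0) \<ge> 1"
  using assms conv_radius_fps_expansion[of f 0 1] by (simp add: one_ereal_def)

lemma
  assumes "f holomorphic_on unit_disc" "g holomorphic_on unit_disc"
  shows analytic_conv_holomorphic: "f \<star> g holomorphic_on unit_disc"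
    and analytic_conv_0: "(f \<star> g) 0 = f 0 * g 0"
    and deriv_analytic_conv_0: "deriv (f \<star> g) 0 = deriv f 0 * deriv g 0"
proof -
  define c where "c = Abs_fps (\<lambda>n. fps_nth (fps_expansion f 0) n * fps_nth (fps_expansion g 0) n)"
  have fg: "f \<star> g = eval_fps c" by (simp add: analytic_conv_def c_def)
  have c1: "fps_conv_radius c \<ge> 1"
    unfolding c_def using assms by (intro fps_conv_radius_Hadamard_ge_1 fps_conv_radius_expansion_ge_1)
  then have c0: "fps_conv_radius c > 0"
    by (rule less_le_trans[rotated]) simp
  have "unit_disc \<subseteq> eball 0 (fps_conv_radius c)"
    using ball_eball_mono[of 1 "fps_conv_radius c" 0] c1 by (simp add: one_ereal_def)
  then show "f \<star> g holomorphic_on unit_disc"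
    unfolding fg by (rule holomorphic_on_eval_fps)
  show "(f \<star> g) 0 = f 0 * g 0"
    by (simp add: fg eval_fps_at_0 c_def fps_expansion_def)
  show "deriv (f \<star> g) 0 = deriv f 0 * deriv g 0"
    using fps_nth_conv_deriv[OF c0, of 1] by (simp add: fg c_def fps_expansion_def)
qed

text \<open>Except at index \<open>1\<close> the coefficients of \<open>h1\<close> and \<open>g1\<close> agree, and at index \<open>1\<close> the
  coefficient of \<open>g2\<close> vanishes; so in the second product \<open>g1\<close> may be replaced by \<open>h1\<close>.\<close>

lemma analytic_conv_diff:
  assumes hol: "h1 holomorphic_on unit_disc" "g1 holomorphic_on unit_disc"
      "h2 holomorphic_on unit_disc" "g2 holomorphic_on unit_disc"
    and 1: "\<And>z. z \<in> unit_disc \<Longrightarrow> h1 z - g1 z = z"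
    and 2: "\<And>z. z \<in> unit_disc \<Longrightarrow> h2 z - g2 z = \<phi> z"
    and g2: "deriv g2 0 = 0" and z: "z \<in> unit_disc"
  shows "(h1 \<star> h2) z - (g1 \<star> g2) z = (h1 \<star> \<phi>) z"
proof -
  let ?E = "\<lambda>f. fps_expansion f 0"
  let ?P = "\<lambda>f g. Abs_fps (\<lambda>n. fps_nth (?E f) n * fps_nth (?E g) n)"
  have expand: "f has_fps_expansion ?E f" if "f holomorphic_on unit_disc" for f
    using that by (intro has_fps_expansion_fps_expansion[OF open_ball]) auto
  have "fps_X = ?E (\<lambda>z. h1 z - g1 z)"
    using fps_expansion_cong_disc[OF 1] fps_expansion_eqI[OF has_fps_expansion_fps_X] by simp
  also have "\<dots> = ?E h1 - ?E g1"
    using hol by (intro fps_expansion_eqI has_fps_expansion_diff expand)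
  finally have E1: "?E g1 = ?E h1 - fps_X" by (simp add: algebra_simps)
  have "?E \<phi> = ?E (\<lambda>z. h2 z - g2 z)"
    using fps_expansion_cong_disc[OF 2] by simp
  also have "\<dots> = ?E h2 - ?E g2"
    using hol by (intro fps_expansion_eqI has_fps_expansion_diff expand)
  finally have E2: "?E \<phi> = ?E h2 - ?E g2" .
  have "fps_nth (?E g2) 1 = 0"
    using g2 by (simp add: fps_expansion_def)
  then have "?P h1 h2 - ?P g1 g2 = ?P h1 \<phi>"
    by (auto simp: fps_eq_iff E1 E2 fps_X_nth algebra_simps)
  moreover have "ereal (norm z) < fps_conv_radius (?P h1 h2)" "ereal (norm z) < fps_conv_radius (?P g1 g2)"
  proof -
    have z1: "ereal (norm z) < 1" using z by (simp add: one_ereal_def)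
    show "ereal (norm z) < fps_conv_radius (?P h1 h2)" "ereal (norm z) < fps_conv_radius (?P g1 g2)"
      by (intro order.strict_trans2[OF z1] fps_conv_radius_Hadamard_ge_1
          fps_conv_radius_expansion_ge_1 hol)+
  qed
  ultimately show ?thesis
    using eval_fps_diff[of z "?P h1 h2" "?P g1 g2"] by (simp add: analytic_conv_def)
qed

lemma canonical_decomp_harmonic_conv:
  assumes "canonical_decomp f h g" "canonical_decomp F H G"
  shows "canonical_decomp (f \<star>\<^sub>H F) (h \<star> H) (g \<star> G)"
  using assms analytic_conv_holomorphic analytic_conv_0 deriv_analytic_conv_0
  unfolding harmonic_conv_eq[OF assms] canonical_decomp_def by simp

section \<open>The shear construction of Clunie and Sheil-Small\<close>

text \<open>With \<open>t = a / (a - b)\<close>, so that \<open>b / (a - b) = t - 1\<close>, the claim is \<open>|t - 1| < |t|\<close>: the half-plane \<open>Re t > 1 / 2\<close> consists of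
  the points closer to \<open>1\<close> than to \<open>0\<close>.\<close>

lemma norm_less_if_Re_quotient_gt_half:
  fixes a b :: complex
  assumes "Re (a / (a - b)) > 1 / 2"
  shows "norm b < norm a"
proof -
  have ne: "a - b \<noteq> 0" using assms by auto
  define t where "t = a / (a - b)"
  have a: "a = t * (a - b)" and b: "b = (t - 1) * (a - b)"
    using ne by (simp_all add: t_def field_simps)
  have "(norm (t - 1))\<^sup>2 < (norm t)\<^sup>2"
    using assms unfolding t_def[symmetric] cmod_power2 by (simp add: power2_eq_square algebra_simps)
  then have "norm (t - 1) < norm t"
    by (rule power_less_imp_less_base) simp
  then have "norm (t - 1) * norm (a - b) < norm t * norm (a - b)"
    using ne by (intro mult_strict_right_mono) auto
  then show ?thesis
    using a b by (metis norm_mult)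
qed

text \<open>The real part of \<open>w + 2 * Re (q w)\<close> has derivative \<open>1 + 2 * Re (q' w)\<close> along a horizontal
  line. Positivity of this derivative gives monotonicity only because the segment from \<open>w1\<close> to \<open>w2\<close>
  lies in \<open>D\<close>, which is what convexity in the direction of the real axis supplies.\<close>

lemma strictly_increasing_along_lines:
  fixes q :: "complex \<Rightarrow> complex" and D :: "complex set"
  assumes D: "open D" "convex_real_direction D" and q: "q holomorphic_on D"
    and pos: "\<And>w. w \<in> D \<Longrightarrow> 1 + 2 * Re (deriv q w) > 0"
    and w: "w1 \<in> D" "w2 \<in> D" "Im w1 = Im w2" "Re w1 < Re w2"
  shows "Re w1 + 2 * Re (q w1) < Re w2 + 2 * Re (q w2)"
proof -
  define c where "c = Im w1"
  let ?w = "\<lambda>t. of_real t + \<i> * of_real c"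
  let ?k = "\<lambda>t. t + 2 * Re (q (?w t))"
  have ends: "?w (Re w1) = w1" "?w (Re w2) = w2"
    using w(3) by (simp_all add: c_def complex_eq_iff)
  have "connected (Re ` (D \<inter> {w. Im w = c}))"
    using D(2) by (intro connected_continuous_image continuous_intros) (auto simp: convex_real_direction_def)
  moreover have "Re w1 \<in> Re ` (D \<inter> {w. Im w = c})" "Re w2 \<in> Re ` (D \<inter> {w. Im w = c})"
    using w(1-3) by (auto simp: c_def)
  ultimately have seg: "{Re w1..Re w2} \<subseteq> Re ` (D \<inter> {w. Im w = c})"
    by (rule connected_contains_Icc)
  have inD: "?w t \<in> D" if t: "Re w1 \<le> t" "t \<le> Re w2" for t
  proof -
    obtain w where "w \<in> D" "Im w = c" "Re w = t" using seg t by fastforce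
    moreover from this have "?w t = w" by (simp add: complex_eq_iff)
    ultimately show ?thesis by simp
  qed
  have "?k (Re w1) < ?k (Re w2)"
  proof (rule DERIV_pos_imp_increasing[OF w(4)])
    fix t assume t: "Re w1 \<le> t" "t \<le> Re w2"
    let ?q' = "deriv q (?w t)"
    have "(q has_field_derivative ?q') (at (?w t))"
      using q D(1) inD[OF t] by (rule holomorphic_derivI)
    then have "((\<lambda>u. q (u + \<i> * of_real c)) has_field_derivative ?q') (at (of_real t))"
      by (simp add: DERIV_shift)
    then have "((\<lambda>t. q (?w t)) has_vector_derivative ?q') (at t)"
      by (rule has_vector_derivative_real_field)
    then have "((\<lambda>t. Re (q (?w t))) has_real_derivative Re ?q') (at t)"
      unfolding has_real_derivative_iff_has_vector_derivative
      by (rule bounded_linear.has_vector_derivative[OF bounded_linear_Re])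
    then have "(?k has_real_derivative 1 + 2 * Re ?q') (at t)"
      by (intro DERIV_add DERIV_ident DERIV_cmult)
    then show "\<exists>y. (?k has_real_derivative y) (at t) \<and> 0 < y"
      using pos[OF inD[OF t]] by blast
  qed
  then show ?thesis by (simp add: ends)
qed

text \<open>The map \<open>z \<mapsto> h z + cnj (g z)\<close> is \<open>P \<circ> \<Phi>\<close> for \<open>P w = w + 2 * Re (q w)\<close> and
  \<open>q = g \<circ> \<Phi>\<^sup>-\<^sup>1\<close>, and the hypothesis on \<open>h' / \<Phi>'\<close> is exactly positivity of \<open>1 + 2 * Re q'\<close>.
  As \<open>P\<close> preserves imaginary parts, points with equal images lie on one horizontal line, where \<open>P\<close> is
  strictly increasing, and each horizontal slice of the image is the \<open>P\<close>-image of the corresponding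
  slice of \<open>\<Phi> ` S\<close>.\<close>

lemma shear_univalent:
  fixes h g \<Phi> :: "complex \<Rightarrow> complex"
  assumes S: "open S" and h: "h holomorphic_on S" and g: "g holomorphic_on S"
    and \<Phi>: "\<And>z. z \<in> S \<Longrightarrow> h z - g z = \<Phi> z"
    and inj: "inj_on \<Phi> S" and conv: "convex_real_direction (\<Phi> ` S)"
    and half: "\<And>z. z \<in> S \<Longrightarrow> Re (deriv h z / deriv \<Phi> z) > 1 / 2"
  shows "inj_on (\<lambda>z. h z + cnj (g z)) S"
    and "convex_real_direction ((\<lambda>z. h z + cnj (g z)) ` S)"
    and "\<And>z. z \<in> S \<Longrightarrow> norm (deriv g z) < norm (deriv h z)"
proof -
  let ?f = "\<lambda>z. h z + cnj (g z)"
  have hol: "\<Phi> holomorphic_on S"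
    using holomorphic_on_diff[OF h g] \<Phi> by (rule holomorphic_transform)
  have deriv\<Phi>: "deriv \<Phi> z = deriv h z - deriv g z" if "z \<in> S" for z
  proof -
    have "((\<lambda>z. h z - g z) has_field_derivative deriv h z - deriv g z) (at z)"
      using S h g that by (intro DERIV_diff holomorphic_derivI)
    then have "(\<Phi> has_field_derivative deriv h z - deriv g z) (at z)"
      by (rule has_field_derivative_transform_within_open[OF _ S that]) (use \<Phi> in auto)
    then show ?thesis by (rule DERIV_imp_deriv)
  qed
  show "norm (deriv g z) < norm (deriv h z)" if "z \<in> S" for z
    using half[OF that] deriv\<Phi>[OF that] by (intro norm_less_if_Re_quotient_gt_half) simp
  obtain \<psi> where \<psi>: "\<psi> holomorphic_on \<Phi> ` S"
    and deriv\<psi>: "\<And>z. z \<in> S \<Longrightarrow> deriv \<Phi> z * deriv \<psi> (\<Phi> z) = 1"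
    and inv: "\<And>z. z \<in> S \<Longrightarrow> \<psi> (\<Phi> z) = z"
    using holomorphic_has_inverse[OF hol S inj] by blast
  have D: "open (\<Phi> ` S)"
    using open_mapping_thm3[OF hol S inj] .
  define q where "q = g \<circ> \<psi>"
  have q: "q holomorphic_on \<Phi> ` S"
    unfolding q_def by (rule holomorphic_on_compose_gen[OF \<psi> g]) (use inv in auto)
  have pos: "1 + 2 * Re (deriv q w) > 0" if w: "w \<in> \<Phi> ` S" for w
  proof -
    obtain z where z: "z \<in> S" "w = \<Phi> z" using w by blast
    have "deriv q w = deriv g (\<psi> w) * deriv \<psi> w"
      unfolding q_def using z inv
      by (intro deriv_chain holomorphic_on_imp_differentiable_at[OF \<psi> D]
          holomorphic_on_imp_differentiable_at[OF g S]) auto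
    also have "deriv \<psi> w = 1 / deriv \<Phi> z"
      using deriv\<psi>[OF z(1)] z(2) by (metis mult_zero_left nonzero_eq_divide_eq mult.commute zero_neq_one)
    also have "deriv g (\<psi> w) * (1 / deriv \<Phi> z) = deriv h z / deriv \<Phi> z - 1"
    proof -
      have "deriv \<Phi> z \<noteq> 0" using deriv\<psi>[OF z(1)] by auto
      then show ?thesis
        using inv[OF z(1)] z deriv\<Phi>[OF z(1)] by (simp add: divide_simps)
    qed
    finally show ?thesis using half[OF z(1)] by simp
  qed
  define P where "P = (\<lambda>w. w + of_real (2 * Re (q w)))"
  have f: "?f z = P (\<Phi> z)" if "z \<in> S" for z
    unfolding P_def q_def o_def inv[OF that] using \<Phi>[OF that] by (simp add: complex_eq_iff)
  have ImP: "Im (P w) = Im w" for w by (simp add: P_def)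
  have "inj_on P (\<Phi> ` S)"
  proof (rule inj_onI)
    fix w1 w2 assume w: "w1 \<in> \<Phi> ` S" "w2 \<in> \<Phi> ` S" and P: "P w1 = P w2"
    have Im: "Im w1 = Im w2" using P ImP by metis
    have "Re w1 + 2 * Re (q w1) = Re w2 + 2 * Re (q w2)"
      using P by (simp add: P_def complex_eq_iff)
    then have "Re w1 = Re w2"
      using strictly_increasing_along_lines[OF D conv q pos] w Im
      by (metis less_irrefl linorder_less_linear)
    with Im show "w1 = w2" by (simp add: complex_eq_iff)
  qed
  then have "inj_on (P \<circ> \<Phi>) S" using inj by (rule comp_inj_on[rotated])
  then show "inj_on ?f S"
    using f by (simp add: inj_on_def)
  show "convex_real_direction (?f ` S)"
    unfolding convex_real_direction_def
  proof
    fix c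
    have "?f ` S = P ` \<Phi> ` S" using f by force
    then have "?f ` S \<inter> {w. Im w = c} = P ` (\<Phi> ` S \<inter> {w. Im w = c})"
      using ImP by auto
    moreover have "continuous_on (\<Phi> ` S) P"
      unfolding P_def by (intro continuous_intros holomorphic_on_imp_continuous_on[OF q])
    ultimately show "connected (?f ` S \<inter> {w. Im w = c})"
      using conv unfolding convex_real_direction_def
      by (metis connected_continuous_image continuous_on_subset inf_le1)
  qed
qed

theorem theorem2p1:
  fixes \<phi> f1 h1 g1 f2 h2 g2 :: "complex \<Rightarrow> complex"
  assumes "\<phi> \<in> class_A"
    and "f1 \<in> W_H_minus (\<lambda>z. z)" and "canonical_decomp f1 h1 g1"
    and "f2 \<in> W_H_minus \<phi>" and "canonical_decomp f2 h2 g2"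
  shows "f1 \<star>\<^sub>H f2 \<in> W_H_minus (h1 \<star> \<phi>) \<and>
         (inj_on (h1 \<star> \<phi>) unit_disc \<and>
          maps_convex_real_direction (h1 \<star> \<phi>) \<and>
          (\<forall>z\<in>unit_disc. Re (deriv (h1 \<star> h2) z / deriv (h1 \<star> \<phi>) z) > 1 / 2)
          \<longrightarrow> f1 \<star>\<^sub>H f2 \<in> class_S_H0 \<and> maps_convex_real_direction (f1 \<star>\<^sub>H f2))"
proof -
  let ?H = "h1 \<star> h2" and ?G = "g1 \<star> g2" and ?\<Phi> = "h1 \<star> \<phi>" and ?f = "f1 \<star>\<^sub>H f2"
  note dec = canonical_decomp_harmonic_conv[OF assms(3,5)]
  have f: "?f = (\<lambda>z. ?H z + cnj (?G z))"
    using harmonic_conv_eq[OF assms(3,5)] .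
  have diff: "h z - g z = \<omega> z"
    if f: "f \<in> W_H_minus \<omega>" "canonical_decomp f h g" and z: "z \<in> unit_disc" for f h g \<omega> z
  proof -
    obtain h' g' where "canonical_decomp f h' g'" "h' z - g' z = \<omega> z"
      using f(1) z unfolding W_H_minus_def by blast
    then show ?thesis
      using canonical_decomp_unique[OF f(2) _ z] by metis
  qed
  have "h1 z - g1 z = z" and "h2 z - g2 z = \<phi> z" if "z \<in> unit_disc" for z
    using diff[OF assms(2,3) that] diff[OF assms(4,5) that] .
  then have \<Phi>: "?H z - ?G z = ?\<Phi> z" if "z \<in> unit_disc" for z
    using assms(3,5) that by (intro analytic_conv_diff) (auto simp: canonical_decomp_def)
  have H: "?f \<in> class_H"
    using dec by (rule canonical_decomp_imp_class_H)
  have hol: "?H holomorphic_on unit_disc" "?G holomorphic_on unit_disc"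
    using dec by (auto simp: canonical_decomp_def)
  have "?f \<in> class_S_H0 \<and> maps_convex_real_direction ?f"
    if inj: "inj_on ?\<Phi> unit_disc" and conv: "maps_convex_real_direction ?\<Phi>"
      and half: "\<forall>z\<in>unit_disc. Re (deriv ?H z / deriv ?\<Phi> z) > 1 / 2"
  proof -
    have "convex_real_direction (?\<Phi> ` unit_disc)"
      using conv by (simp add: maps_convex_real_direction_def)
    note shear = shear_univalent[OF open_ball hol \<Phi> inj this half[rule_format], folded f]
    have cont: "continuous_on unit_disc ?f"
      unfolding f using hol by (intro continuous_intros holomorphic_on_imp_continuous_on)
    have "sense_preserving ?f"
      unfolding sense_preserving_def using dec shear(3) by blast
    moreover have "open (?f ` unit_disc)"
      using cont open_ball shear(1) by (rule invariance_of_domain)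
    moreover have "connected (?f ` unit_disc)"
      using cont by (rule connected_continuous_image) simp
    ultimately show ?thesis
      using H shear(1,2) by (simp add: class_S_H0_def maps_convex_real_direction_def)
  qed
  then show ?thesis
    using H dec \<Phi> unfolding W_H_minus_def by blast
qed

end
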